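(* Let $d\in\mathbb{N}$. There exist three positive constants $C_1(d)$, $C_2$, $C_3$, where $C_1(d)$ depends only on $d$ and $C_2,C_3$ are absolute constants, such that for any $n,v\in\mathbb{N}$ with $v\le|\Pi_n|$ there is a set $\xi=\{\xi^\nu\}_{\nu=1}^m\subset\mathbb{T}^d$, with $m\le C_1(d)v^2n^{9/2}$, which provides universal discretization in $L_1$ for the collection $\mathcal{S}(v,n)$: for any $f\in\bigcup_{Q\in\mathcal{S}(v,n)}\mathcal{T}(Q)$, $$C_2\|f\|_1\le\frac1m\sum_{\nu=1}^m|f(\xi^\nu)|\le C_3\|f\|_1 .$$
   Context: $\mathbb{T}^d$ is the $d$-dimensional torus $[0,2\pi)^d$ with normalized Lebesgue measure $\mu$, and $\|f\|_1=\int_{\mathbb{T}^d}|f|\,d\mu$. For a finite set $Q\subset\mathbb{Z}^d$, $\mathcal{T}(Q):=\{f:\ f(\mathbf{x})=\sum_{\mathbf{k}\in Q}c_{\mathbf{k}}e^{i(\mathbf{k},\mathbf{x})},\ c_{\mathbf{k}}\in\mathbb{C}\}$. For $n\in\mathbb{N}$, $\Pi_n:=\{\mathbf{k}\in\mathbb{Z}^d:\ |k_j|\le 2^{n-1}-1,\ j=1,\dots,d\}$, and $\mathcal{S}(v,n):=\{Q\subset\Pi_n:\ |Q|=v\}$, where $|\cdot|$ denotes cardinality. *)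

theory Defs
  imports "HOL-Probability.Probability"
begin

text \<open>
  The dimension is a natural number rather than a type, because two of the constants in the
  theorem must not depend on it. Points of the torus and frequencies are extensional functions
  on the index set \<open>{1..d}\<close>.
\<close>

definition torus :: "nat \<Rightarrow> (nat \<Rightarrow> real) set" where
  "torus d = PiE {1..d} (\<lambda>_. {0..<2 * pi})"

text \<open>
  The space of this measure consists of all extensional functions, but it is concentrated on
  \<open>torus d\<close>, where it is Lebesgue measure divided by \<open>(2 * pi) ^ d\<close>.
\<close>

definition torus_measure :: "nat \<Rightarrow> (nat \<Rightarrow> real) measure" where
  "torus_measure d = PiM {1..d} (\<lambda>_. uniform_measure lborel {0..<2 * pi})"

definition L1_norm :: "nat \<Rightarrow> ((nat \<Rightarrow> real) \<Rightarrow> complex) \<Rightarrow> real" where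
  "L1_norm d f = (LINT x|torus_measure d. cmod (f x))"

definition trig_polys :: "nat \<Rightarrow> (nat \<Rightarrow> int) set \<Rightarrow> ((nat \<Rightarrow> real) \<Rightarrow> complex) set" where
  "trig_polys d Q =
     {f. \<exists>c :: (nat \<Rightarrow> int) \<Rightarrow> complex.
           f = (\<lambda>x. \<Sum>k\<in>Q. c k * exp (\<i> * complex_of_real (\<Sum>j=1..d. of_int (k j) * x j)))}"

text \<open>Used for \<open>n \<ge> 1\<close> only, so the subtraction in the exponent is not truncated.\<close>

definition freq_cube :: "nat \<Rightarrow> nat \<Rightarrow> (nat \<Rightarrow> int) set" where
  "freq_cube d n = PiE {1..d} (\<lambda>_. {k. \<bar>k\<bar> \<le> 2 ^ (n - 1) - 1})"

definition sparse_sets :: "nat \<Rightarrow> nat \<Rightarrow> nat \<Rightarrow> (nat \<Rightarrow> int) set set" where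
  "sparse_sets d v n = {Q. Q \<subseteq> freq_cube d n \<and> card Q = v}"

definition universal_L1_discretization ::
  "nat \<Rightarrow> (nat \<Rightarrow> int) set set \<Rightarrow> real \<Rightarrow> real \<Rightarrow> nat \<Rightarrow> (nat \<Rightarrow> nat \<Rightarrow> real) \<Rightarrow> bool" where
  "universal_L1_discretization d \<Q> C2 C3 m \<xi> \<longleftrightarrow>
     (\<forall>f \<in> (\<Union>Q\<in>\<Q>. trig_polys d Q).
        C2 * L1_norm d f \<le> (1 / real m) * (\<Sum>\<nu>=1..m. cmod (f (\<xi> \<nu>))) \<and>
        (1 / real m) * (\<Sum>\<nu>=1..m. cmod (f (\<xi> \<nu>))) \<le> C3 * L1_norm d f)"

end

theory Submission
  imports Defs
begin

text \<open>
  A sparse trigonometric polynomial \<open>f\<close> with \<open>\<parallel>f\<parallel>\<^sub>1 = 1\<close> has Fourier coefficients of modulus at most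
  one. Rounding them to a grid of mesh of order \<open>1 / v\<close> moves \<open>f\<close> by at most \<open>1 / 16\<close> uniformly and
  yields a net of at most \<open>exp (O (d n v))\<close> functions, each bounded by \<open>2 v\<close> and with mean value
  between \<open>1 / 2\<close> and \<open>2\<close>. For one such function, a Chernoff bound shows that the average over \<open>m\<close>
  random points leaves \<open>[1 / 8, 5]\<close> with probability at most \<open>exp (- c m / v)\<close>. Only constants are
  asked for, so neither the variance nor the exact mean matters, and \<open>m = O (d n v\<^sup>2)\<close> points
  suffice for the whole net.
\<close>

section \<open>Choosing sample points: conditional expectations and exponential moments\<close>

text \<open>If \<open>h\<close> exceeded its mean wherever \<open>P\<close> holds, hence almost
  everywhere, the mean would be strictly larger than itself. Carrying \<open>P\<close> along lets
  the chosen point also meet almost sure side conditions.\<close>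

lemma (in prob_space) exists_le_expectation:
  fixes h :: "'a \<Rightarrow> real"
  assumes h: "integrable M h" and P: "AE x in M. P x"
  shows "\<exists>x. P x \<and> h x \<le> expectation h"
proof (rule ccontr)
  assume "\<not> ?thesis"
  with P have "AE x in M. expectation h < h x"
    by (auto elim!: eventually_mono simp: not_le)
  then have "expectation (\<lambda>_. expectation h) < expectation h"
    using h by (intro integral_less_AE_space) (auto simp: emeasure_space_1)
  then show False
    by (simp add: prob_space)
qed

text \<open>The method of conditional expectations: each new point is chosen so that the sum of the
  partial products does not grow. This replaces independent sampling and makes it easy to keep the
  points distinct.\<close>

lemma (in prob_space) exists_points_sum_prod_le:
  fixes U :: "('a \<Rightarrow> real) set"
  assumes "finite U"
    and int: "\<And>u. u \<in> U \<Longrightarrow> integrable M u"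
    and le1: "\<And>u. u \<in> U \<Longrightarrow> expectation u \<le> 1"
    and nonneg: "\<And>u x. u \<in> U \<Longrightarrow> 0 \<le> u x"
    and P: "AE x in M. P x"
    and diffuse: "\<And>p. AE x in M. x \<noteq> p"
  shows "\<exists>\<xi> :: nat \<Rightarrow> 'a. inj_on \<xi> {1..m} \<and> (\<forall>\<nu>\<in>{1..m}. P (\<xi> \<nu>)) \<and>
           (\<Sum>u\<in>U. \<Prod>\<nu>=1..m. u (\<xi> \<nu>)) \<le> real (card U)"
proof (induction m)
  case 0
  then show ?case by auto
next
  case (Suc m)
  then obtain \<xi> :: "nat \<Rightarrow> 'a" where \<xi>: "inj_on \<xi> {1..m}" "\<forall>\<nu>\<in>{1..m}. P (\<xi> \<nu>)"
    "(\<Sum>u\<in>U. \<Prod>\<nu>=1..m. u (\<xi> \<nu>)) \<le> real (card U)"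
    by blast
  define h where "h x = (\<Sum>u\<in>U. (\<Prod>\<nu>=1..m. u (\<xi> \<nu>)) * u x)" for x
  have h: "integrable M h"
    unfolding h_def using int by auto
  \<comment> \<open>Finitely many points are null by \<open>diffuse\<close>, so avoiding the earlier
    choices is one more almost sure condition.\<close>
  have "AE x in M. \<forall>p\<in>\<xi> ` {1..m}. x \<noteq> p"
    using diffuse by (intro eventually_ball_finite) auto
  with P have "AE x in M. P x \<and> x \<notin> \<xi> ` {1..m}"
    by eventually_elim auto
  then obtain x where x: "P x" "x \<notin> \<xi> ` {1..m}" "h x \<le> expectation h"
    using exists_le_expectation[OF h, of "\<lambda>x. P x \<and> x \<notin> \<xi> ` {1..m}"] by blast
  have "expectation h = (\<Sum>u\<in>U. (\<Prod>\<nu>=1..m. u (\<xi> \<nu>)) * expectation u)"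
    unfolding h_def using int by simp
  also have "\<dots> \<le> (\<Sum>u\<in>U. \<Prod>\<nu>=1..m. u (\<xi> \<nu>))"
    using le1 nonneg by (intro sum_mono mult_left_le prod_nonneg) auto
  finally have hx: "h x \<le> real (card U)"
    using \<xi> x by linarith
  define \<eta> where "\<eta> = \<xi>(Suc m := x)"
  have \<eta>: "\<eta> (Suc m) = x" "\<And>\<nu>. \<nu> \<in> {1..m} \<Longrightarrow> \<eta> \<nu> = \<xi> \<nu>"
    by (auto simp: \<eta>_def)
  have interval: "{1..Suc m} = insert (Suc m) {1..m}" by auto
  have "\<eta> ` {1..m} = \<xi> ` {1..m}"
    using \<eta>(2) by (rule image_cong[OF refl])
  moreover have "inj_on \<eta> {1..m} \<longleftrightarrow> inj_on \<xi> {1..m}"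
    using \<eta>(2) by (rule inj_on_cong)
  ultimately have "inj_on \<eta> {1..Suc m}"
    using x(2) \<xi>(1) unfolding interval by (simp add: \<eta>(1))
  moreover have "\<forall>\<nu>\<in>{1..Suc m}. P (\<eta> \<nu>)"
    using \<xi>(2) x(1) \<eta> unfolding interval by (metis insertE)
  moreover have "(\<Sum>u\<in>U. \<Prod>\<nu>=1..Suc m. u (\<eta> \<nu>)) = h x"
  proof -
    have "(\<Prod>\<nu>=1..m. u (\<eta> \<nu>)) = (\<Prod>\<nu>=1..m. u (\<xi> \<nu>))" for u :: "'a \<Rightarrow> real"
      by (rule prod.cong) (simp_all only: \<eta>(2))
    then show ?thesis by (simp add: h_def \<eta>(1) del: One_nat_def)
  qed
  ultimately show ?case
    using hx by metis
qed

text \<open>A linear majorant on [0, 1] bounds an exponential moment by the mean alone; the sharp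
  slope e - 1 is rounded up to 2.\<close>

lemma exp_le_1_plus_2:
  fixes t :: real
  assumes "0 \<le> t" "t \<le> 1"
  shows "exp t \<le> 1 + 2 * t"
proof -
  have "t\<^sup>2 \<le> t" using assms by (simp add: power2_eq_square mult_left_le)
  then show ?thesis using exp_bound[OF assms] by simp
qed

text \<open>Because t^2 is at most t, the product of 1 + t and 1 - t/2 is at least 1, and 1 + t is
  at most exp t. This serves the lower tail.\<close>

lemma exp_minus_le_1_minus_half:
  fixes t :: real
  assumes "0 \<le> t" "t \<le> 1"
  shows "exp (- t) \<le> 1 - t / 2"
proof -
  have "1 \<le> (1 + t) * (1 - t / 2)"
    using assms mult_left_le[of t t] by (simp add: algebra_simps)
  also have "\<dots> \<le> exp t * (1 - t / 2)"
    using assms by (intro mult_right_mono exp_ge_add_one_self) auto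
  finally show ?thesis by (simp add: exp_minus field_simps)
qed

text \<open>A Chernoff bound and a union bound in one. Each tail of each \<open>g\<close>
  contributes a function of mean at most 1 whose product over the points is the exponential of a
  deviation. These are at most \<open>2 * card G\<close> functions, so the sum of the products, and
  hence each of them, can be kept below \<open>exp L\<close>. Taking logarithms leaves an error of
  \<open>B * L\<close>.\<close>

lemma (in prob_space) exists_points_sampling:
  fixes G :: "('a \<Rightarrow> real) set"
  assumes "finite G" and "0 < B"
    and meas: "\<And>g. g \<in> G \<Longrightarrow> g \<in> borel_measurable M"
    and bounds: "\<And>g x. g \<in> G \<Longrightarrow> 0 \<le> g x \<and> g x \<le> B"
    and expect: "\<And>g. g \<in> G \<Longrightarrow> 1/2 \<le> expectation g \<and> expectation g \<le> 2"
    and P: "AE x in M. P x"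
    and diffuse: "\<And>p. AE x in M. x \<noteq> p"
    and m: "8 * B * L \<le> real m" and L: "2 * real (card G) \<le> exp L"
  shows "\<exists>\<xi> :: nat \<Rightarrow> 'a. inj_on \<xi> {1..m} \<and> (\<forall>\<nu>\<in>{1..m}. P (\<xi> \<nu>)) \<and>
           (\<forall>g\<in>G. real m / 8 \<le> (\<Sum>\<nu>=1..m. g (\<xi> \<nu>)) \<and> (\<Sum>\<nu>=1..m. g (\<xi> \<nu>)) \<le> 5 * real m)"
proof -
  \<comment> \<open>Dividing by \<open>B\<close> brings the exponent into [0, 1]. The shifts make
    the means at most 1: for a mean of \<open>g\<close> in [1/2, 2] the linear bounds give 1 + 4/B,
    at most exp (4/B), for the upper tail and 1 - 1/(4B), at most exp (-1/(4B)), for the lower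
    one.\<close>
  define p where "p g x = exp (g x / B - 4 / B)" for g :: "'a \<Rightarrow> real" and x
  define q where "q g x = exp (1 / (4 * B) - g x / B)" for g :: "'a \<Rightarrow> real" and x
  define U where "U = p ` G \<union> q ` G"
  have int: "integrable M g" if "g \<in> G" for g
    using meas bounds that by (intro integrable_const_bound[of _ B]) auto
  have "finite U" using \<open>finite G\<close> by (simp add: U_def)
  have "card U \<le> card (p ` G) + card (q ` G)" by (simp add: U_def card_Un_le)
  also have "\<dots> \<le> 2 * card G"
    using card_image_le[OF \<open>finite G\<close>, of p] card_image_le[OF \<open>finite G\<close>, of q] by simp
  finally have cardU: "real (card U) \<le> exp L" using L by linarith
  have intp: "integrable M (p g)" "expectation (p g) \<le> 1" if g: "g \<in> G" for g
  proof -
    have le: "p g x \<le> exp (- 4 / B) * (1 + 2 * (g x / B))" for x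
    proof -
      have "p g x = exp (- 4 / B) * exp (g x / B)"
        by (simp add: p_def exp_add[symmetric])
      then show ?thesis
        using exp_le_1_plus_2[of "g x / B"] bounds[OF g, of x] \<open>0 < B\<close> by simp
    qed
    have "p g x \<le> exp 1" for x
    proof -
      have "g x / B - 4 / B \<le> 1"
        using bounds[OF g, of x] \<open>0 < B\<close> by (simp add: field_simps)
      then show ?thesis by (simp add: p_def)
    qed
    then show I: "integrable M (p g)"
      using meas[OF g] by (intro integrable_const_bound[of _ "exp 1"])
        (auto simp: p_def[abs_def])
    have "expectation (p g) \<le> expectation (\<lambda>x. exp (- 4 / B) * (1 + 2 * (g x / B)))"
      using I int[OF g] le by (intro integral_mono) auto
    also have "\<dots> = exp (- 4 / B) * (1 + 2 * (expectation g / B))"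
      using int[OF g] by (simp add: prob_space)
    also have "\<dots> \<le> exp (- 4 / B) * (1 + 4 / B)"
      using expect[OF g] \<open>0 < B\<close> by (intro mult_left_mono) (auto simp: field_simps)
    also have "\<dots> \<le> exp (- 4 / B) * exp (4 / B)"
      by (intro mult_left_mono exp_ge_add_one_self) auto
    finally show "expectation (p g) \<le> 1" by (simp add: exp_minus)
  qed
  have intq: "integrable M (q g)" "expectation (q g) \<le> 1" if g: "g \<in> G" for g
  proof -
    have le: "q g x \<le> exp (1 / (4 * B)) * (1 - g x / B / 2)" for x
    proof -
      have "q g x = exp (1 / (4 * B)) * exp (- (g x / B))"
        by (simp add: q_def exp_diff exp_minus field_simps)
      then show ?thesis
        using exp_minus_le_1_minus_half[of "g x / B"] bounds[OF g, of x] \<open>0 < B\<close>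
        by simp
    qed
    have "q g x \<le> exp (1 / (4 * B))" for x
      using bounds[OF g, of x] \<open>0 < B\<close> by (simp add: q_def)
    then show I: "integrable M (q g)"
      using meas[OF g] by (intro integrable_const_bound[of _ "exp (1 / (4 * B))"])
        (auto simp: q_def[abs_def])
    have "expectation (q g) \<le> expectation (\<lambda>x. exp (1 / (4 * B)) * (1 - g x / B / 2))"
      using I int[OF g] le by (intro integral_mono) auto
    also have "\<dots> = exp (1 / (4 * B)) * (1 - expectation g / B / 2)"
      using int[OF g] by (simp add: prob_space)
    also have "\<dots> \<le> exp (1 / (4 * B)) * (1 + - (1 / (4 * B)))"
      using expect[OF g] \<open>0 < B\<close> by (intro mult_left_mono) (auto simp: field_simps)
    also have "\<dots> \<le> exp (1 / (4 * B)) * exp (- (1 / (4 * B)))"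
      by (intro mult_left_mono exp_ge_add_one_self) auto
    finally show "expectation (q g) \<le> 1" by (simp add: exp_minus)
  qed
  have intU: "integrable M u" "expectation u \<le> 1" if "u \<in> U" for u
    using that intp intq by (auto simp: U_def)
  have nonneg: "0 \<le> u x" if "u \<in> U" for u x
    using that by (auto simp: U_def p_def q_def)
  have "\<exists>\<xi> :: nat \<Rightarrow> 'a. inj_on \<xi> {1..m} \<and> (\<forall>\<nu>\<in>{1..m}. P (\<xi> \<nu>)) \<and>
      (\<Sum>u\<in>U. \<Prod>\<nu>=1..m. u (\<xi> \<nu>)) \<le> real (card U)"
    using \<open>finite U\<close> intU nonneg P diffuse by (rule exists_points_sum_prod_le)
  then obtain \<xi> :: "nat \<Rightarrow> 'a" where \<xi>: "inj_on \<xi> {1..m}" "\<forall>\<nu>\<in>{1..m}. P (\<xi> \<nu>)"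
    "(\<Sum>u\<in>U. \<Prod>\<nu>=1..m. u (\<xi> \<nu>)) \<le> real (card U)"
    by blast
  have le: "(\<Prod>\<nu>=1..m. u (\<xi> \<nu>)) \<le> exp L" if "u \<in> U" for u
  proof -
    have "(\<Prod>\<nu>=1..m. u (\<xi> \<nu>)) \<le> (\<Sum>u\<in>U. \<Prod>\<nu>=1..m. u (\<xi> \<nu>))"
      using that \<open>finite U\<close> nonneg by (intro member_le_sum prod_nonneg) auto
    then show ?thesis using \<xi>(3) cardU by linarith
  qed
  have "real m / 8 \<le> (\<Sum>\<nu>=1..m. g (\<xi> \<nu>)) \<and> (\<Sum>\<nu>=1..m. g (\<xi> \<nu>)) \<le> 5 * real m"
    if g: "g \<in> G" for g
  proof -
    let ?S = "\<Sum>\<nu>=1..m. g (\<xi> \<nu>)"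
    have "exp (?S / B - real m * (4 / B)) \<le> exp L"
      using le[of "p g"] g
      by (simp add: U_def p_def exp_sum[symmetric] sum_subtractf sum_divide_distrib)
    then have "?S \<le> B * L + 4 * real m"
      using \<open>0 < B\<close> by (simp add: field_simps)
    moreover have "exp (real m * (1 / (4 * B)) - ?S / B) \<le> exp L"
      using le[of "q g"] g
      by (simp add: U_def q_def exp_sum[symmetric] sum_subtractf sum_divide_distrib)
    then have "real m / 4 \<le> B * L + ?S"
      using \<open>0 < B\<close> by (simp add: field_simps)
    \<comment> \<open>Here \<open>B * L\<close> is at most m/8, so the upper bound is 4m + m/8 and
      the lower one m/4 - m/8.\<close>
    ultimately show ?thesis using m by auto
  qed
  then show ?thesis using \<xi> by blast
qed

section \<open>The torus as a product probability space\<close>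

lemma prob_space_circle: "prob_space (uniform_measure lborel {0..<2 * pi})"
  by (rule prob_space_uniform_measure) auto

lemma prob_space_torus: "prob_space (torus_measure d)"
  unfolding torus_measure_def by (intro prob_space_PiM prob_space_circle)

lemma sets_torus_measure: "sets (torus_measure d) = sets (PiM {1..d} (\<lambda>_. borel))"
  unfolding torus_measure_def by (intro sets_PiM_cong) auto

lemma AE_torus: "AE x in torus_measure d. x \<in> torus d"
proof -
  have "AE x in torus_measure d. \<forall>j\<in>{1..d}. x j \<in> {0..<2 * pi}"
    unfolding torus_measure_def
    by (intro eventually_ball_finite ballI AE_PiM_component prob_space_circle AE_uniform_measureI) auto
  moreover have "AE x in torus_measure d. x \<in> space (torus_measure d)"
    by simp
  ultimately show ?thesis
    by eventually_elim (auto simp: torus_def torus_measure_def space_PiM)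
qed

text \<open>One coordinate with a diffuse distribution suffices; for d = 0 the torus would be a
  single atom.\<close>

lemma AE_torus_neq:
  assumes "1 \<le> d"
  shows "AE x in torus_measure d. x \<noteq> p"
proof -
  have "AE y in lborel. y \<noteq> p 1"
    by (rule AE_lborel_singleton)
  then have "AE y in uniform_measure lborel {0..<2 * pi}. y \<noteq> p 1"
    by (intro AE_uniform_measureI) auto
  then have "AE x in torus_measure d. x 1 \<noteq> p 1"
    unfolding torus_measure_def using assms
    by (intro AE_PiM_component prob_space_circle) auto
  then show ?thesis by eventually_elim auto
qed

section \<open>Characters and their orthogonality\<close>

definition character :: "nat \<Rightarrow> (nat \<Rightarrow> int) \<Rightarrow> (nat \<Rightarrow> real) \<Rightarrow> complex" where
  "character d k x = exp (\<i> * complex_of_real (\<Sum>j=1..d. of_int (k j) * x j))"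

lemma norm_character [simp]: "cmod (character d k x) = 1"
  unfolding character_def by simp

lemma borel_measurable_character [measurable]:
  "character d k \<in> borel_measurable (torus_measure d)"
proof -
  have "character d k \<in> borel_measurable (PiM {1..d} (\<lambda>_. borel))"
    unfolding character_def[abs_def] by measurable
  then show ?thesis
    by (simp cong: measurable_cong_sets add: sets_torus_measure)
qed

lemma integrable_character: "integrable (torus_measure d) (character d k)"
proof -
  interpret prob_space "torus_measure d" by (rule prob_space_torus)
  show ?thesis by (intro integrable_const_bound[of _ 1]) auto
qed

text \<open>Since \<open>a\<close> is an integer, the antiderivative takes equal values at 0 and 2
  pi.\<close>

lemma integral_circle_exp:
  fixes a :: int
  assumes "a \<noteq> 0"
  shows "(LINT y|uniform_measure lborel {0..<2 * pi}. exp (\<i> * complex_of_real (of_int a * y))) = 0"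
proof -
  let ?f = "\<lambda>y. exp (\<i> * complex_of_real (of_int a * y))"
  let ?F = "\<lambda>y. exp (\<i> * complex_of_real (of_int a * y)) / (\<i> * of_int a)"
  have F: "(?F has_vector_derivative ?f y) (at y within {0..2*pi})" for y
    using assms by (auto intro!: derivative_eq_intros has_vector_derivative_real_field simp: field_simps)
  have "indicator {0..<2*pi} y / ennreal (2 * pi) = ennreal (indicator {0..<2*pi} y / (2 * pi))" for y
    by (simp add: indicator_def divide_ennreal[symmetric])
  then have "uniform_measure lborel {0..<2 * pi} = density lborel (\<lambda>y. ennreal (indicator {0..<2*pi} y / (2 * pi)))"
    unfolding uniform_measure_def by simp
  then have "(LINT y|uniform_measure lborel {0..<2 * pi}. ?f y) =
      (LINT y|lborel. (indicator {0..<2*pi} y / (2 * pi)) *\<^sub>R ?f y)"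
    by (simp add: integral_density)
  \<comment> \<open>The fundamental theorem of calculus wants a closed interval; the added endpoint
    is null.\<close>
  also have "\<dots> = (LINT y|lborel. (1 / (2 * pi)) *\<^sub>R (indicator {0..2*pi} y *\<^sub>R ?f y))"
    using AE_lborel_singleton[of "2 * pi"]
    by (intro integral_cong_AE) (auto elim!: eventually_mono simp: indicator_def)
  also have "\<dots> = (1 / (2 * pi)) *\<^sub>R (LINT y|lborel. indicator {0..2*pi} y *\<^sub>R ?f y)"
    by (rule integral_scaleR_right)
  also have "(LINT y|lborel. indicator {0..2*pi} y *\<^sub>R ?f y) = ?F (2 * pi) - ?F 0"
    by (intro integral_FTC_atLeastAtMost F continuous_intros) auto
  also have "\<dots> = 0"
    using exp_integer_2pi[of "of_int a"] by (simp add: mult_ac)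
  finally show ?thesis by simp
qed

text \<open>By Fubini the integral is a product of circle integrals, and the factor with index
  \<open>j\<close> vanishes.\<close>

lemma integral_character:
  assumes "j \<in> {1..d}" "k j \<noteq> 0"
  shows "(LINT x|torus_measure d. character d k x) = 0"
proof -
  let ?C = "\<lambda>_. uniform_measure lborel {0..<2 * pi}"
  let ?e = "\<lambda>j y. exp (\<i> * complex_of_real (of_int (k j) * y))"
  interpret C: prob_space "uniform_measure lborel {0..<2 * pi}"
    by (rule prob_space_circle)
  interpret product_sigma_finite ?C
    by unfold_locales
  have "integrable (?C i) (?e i)" for i
    by (intro C.integrable_const_bound[of _ 1]) auto
  then have "(LINT x|PiM {1..d} ?C. (\<Prod>i\<in>{1..d}. ?e i (x i))) = (\<Prod>i\<in>{1..d}. LINT y|?C i. ?e i y)"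
    by (intro product_integral_prod) auto
  also have "\<dots> = 0"
    using assms integral_circle_exp[of "k j"] by (auto simp: prod_zero_iff)
  also have "(\<lambda>x. \<Prod>i\<in>{1..d}. ?e i (x i)) = character d k"
    by (simp add: fun_eq_iff character_def exp_sum[symmetric] sum_distrib_left)
  finally show ?thesis by (simp add: torus_measure_def)
qed

lemma character_mult_cnj:
  "character d k x * cnj (character d l x) = character d (\<lambda>j. k j - l j) x"
proof -
  let ?s = "\<lambda>k. \<Sum>j=1..d. real_of_int (k j) * x j"
  have "?s (\<lambda>j. k j - l j) = ?s k - ?s l"
    by (simp add: sum_subtractf left_diff_distrib)
  moreover have "cnj (character d l x) = exp (- (\<i> * complex_of_real (?s l)))"
    unfolding character_def exp_cnj by simp
  ultimately show ?thesis
    unfolding character_def by (simp only: of_real_diff right_diff_distrib exp_diff exp_minus divide_inverse)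
qed

section \<open>Character sums and their coefficients\<close>

text \<open>The frequencies form a family over any index type, so that one notion covers both a
  polynomial with spectrum \<open>Q\<close> (identity family) and a net element, whose
  \<open>v\<close> numbered frequencies may repeat.\<close>

definition char_sum :: "nat \<Rightarrow> 'i set \<Rightarrow> ('i \<Rightarrow> nat \<Rightarrow> int) \<Rightarrow> ('i \<Rightarrow> complex) \<Rightarrow> (nat \<Rightarrow> real) \<Rightarrow> complex" where
  "char_sum d I k c x = (\<Sum>i\<in>I. c i * character d (k i) x)"

text \<open>Multiplying by a conjugate character keeps the modulus, and by orthogonality the
  integral of the product is the Fourier coefficient. This confines the coefficients of a normalised
  polynomial to the unit disc.\<close>

lemma coeff_le_L1_norm:
  assumes Q: "finite Q" "Q \<subseteq> freq_cube d n" and k: "k \<in> Q"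
  shows "cmod (c k) \<le> L1_norm d (char_sum d Q (\<lambda>k. k) c)"
proof -
  interpret prob_space "torus_measure d" by (rule prob_space_torus)
  let ?f = "\<lambda>x. \<Sum>l\<in>Q. c l * character d l x"
  have "(LINT x|torus_measure d. ?f x * cnj (character d k x)) =
      (\<Sum>l\<in>Q. c l * (LINT x|torus_measure d. character d (\<lambda>j. l j - k j) x))"
    by (simp add: sum_distrib_right mult.assoc character_mult_cnj integrable_character)
  also have "\<dots> = (\<Sum>l\<in>Q. if l = k then c k else 0)"
  proof (rule sum.cong)
    fix l assume l: "l \<in> Q"
    show "c l * (LINT x|torus_measure d. character d (\<lambda>j. l j - k j) x) = (if l = k then c k else 0)"
    proof (cases "l = k")
      case True
      then show ?thesis by (simp add: character_def prob_space)
    next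
      case False
      \<comment> \<open>Frequencies are extensional, so two distinct ones already differ at an index
        in \<open>{1..d}\<close>.\<close>
      then obtain j where "j \<in> {1..d}" "l j \<noteq> k j"
        using PiE_ext[of l "{1..d}" _ k] l k Q(2) unfolding freq_cube_def by blast
      then show ?thesis using False integral_character[of j d "\<lambda>j. l j - k j"] by simp
    qed
  qed simp
  also have "\<dots> = c k" using Q k by simp
  finally have "cmod (c k) \<le> (LINT x|torus_measure d. cmod (?f x * cnj (character d k x)))"
    using integral_norm_bound[of "torus_measure d" "\<lambda>x. ?f x * cnj (character d k x)"] by simp
  then show ?thesis by (simp add: norm_mult L1_norm_def char_sum_def)
qed


lemma borel_measurable_char_sum [measurable]:
  "char_sum d I k c \<in> borel_measurable (torus_measure d)"
  unfolding char_sum_def[abs_def] by measurable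

lemma norm_char_sum_le: "cmod (char_sum d I k c x) \<le> (\<Sum>i\<in>I. cmod (c i))"
  unfolding char_sum_def by (rule sum_norm_le) (simp add: norm_mult)

lemma integrable_norm_char_sum: "integrable (torus_measure d) (\<lambda>x. cmod (char_sum d I k c x))"
proof -
  interpret prob_space "torus_measure d" by (rule prob_space_torus)
  show ?thesis
    by (intro integrable_const_bound[of _ "\<Sum>i\<in>I. cmod (c i)"]) (auto simp: norm_char_sum_le)
qed

lemma norm_char_sum_diff_le:
  assumes "\<And>i. i \<in> I \<Longrightarrow> cmod (c i - c' i) \<le> \<epsilon>"
  shows "\<bar>cmod (char_sum d I k c x) - cmod (char_sum d I k c' x)\<bar> \<le> real (card I) * \<epsilon>"
proof -
  have "char_sum d I k c x - char_sum d I k c' x = char_sum d I k (\<lambda>i. c i - c' i) x"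
    by (simp add: char_sum_def sum_subtractf left_diff_distrib)
  then have "\<bar>cmod (char_sum d I k c x) - cmod (char_sum d I k c' x)\<bar> \<le> (\<Sum>i\<in>I. cmod (c i - c' i))"
    by (metis norm_triangle_ineq3 norm_char_sum_le order_trans)
  also have "\<dots> \<le> real (card I) * \<epsilon>"
    using assms by (rule sum_bounded_above)
  finally show ?thesis .
qed

section \<open>A finite net for sparse polynomials\<close>

text \<open>The lattice of mesh 1/N in the square of side 2 centred at 0, which contains the unit
  disc.\<close>

definition coeff_grid :: "nat \<Rightarrow> complex set" where
  "coeff_grid N = (\<lambda>(a, b). Complex (of_int a / of_nat N) (of_int b / of_nat N)) `
     ({- int N..int N} \<times> {- int N..int N})"

lemma finite_coeff_grid: "finite (coeff_grid N)"
  by (simp add: coeff_grid_def)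

lemma card_coeff_grid_le: "card (coeff_grid N) \<le> (2 * N + 1)\<^sup>2"
proof -
  have "card (coeff_grid N) \<le> card ({- int N..int N} \<times> {- int N..int N})"
    unfolding coeff_grid_def by (intro card_image_le) simp
  also have "\<dots> = (2 * N + 1)\<^sup>2"
    by (simp add: card_cartesian_product power2_eq_square nat_add_distrib nat_mult_distrib)
  finally show ?thesis .
qed

lemma norm_coeff_grid_le:
  assumes "w \<in> coeff_grid N"
  shows "cmod w \<le> 2"
proof -
  from assms obtain a b where ab: "\<bar>a\<bar> \<le> int N" "\<bar>b\<bar> \<le> int N"
    and w: "w = Complex (of_int a / of_nat N) (of_int b / of_nat N)"
    by (force simp: coeff_grid_def abs_le_iff)
  have le1: "\<bar>real_of_int t / real N\<bar> \<le> 1" if "\<bar>t\<bar> \<le> int N" for t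
  proof -
    have "\<bar>real_of_int t\<bar> \<le> real N" using that by linarith
    then show ?thesis by (auto simp: divide_le_eq_1)
  qed
  show ?thesis
    using cmod_le[of w] le1[OF ab(1)] le1[OF ab(2)] by (simp add: w)
qed

text \<open>Real and imaginary parts are rounded down, each with error at most 1/N; they lie in
  [-1, 1], so the floors stay between -N and N.\<close>

lemma coeff_grid_approx:
  assumes "0 < N" "cmod z \<le> 1"
  shows "\<exists>w\<in>coeff_grid N. cmod (z - w) \<le> 2 / real N"
proof -
  let ?r = "\<lambda>t. real_of_int \<lfloor>real N * t\<rfloor> / real N"
  have fl: "\<lfloor>real N * t\<rfloor> \<in> {- int N..int N}" if "\<bar>t\<bar> \<le> 1" for t
  proof -
    have "\<bar>real N * t\<bar> \<le> real N" using that by (simp add: abs_mult mult_left_le)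
    then show ?thesis by (auto simp: abs_le_iff le_floor_iff floor_le_iff)
  qed
  have err: "\<bar>t - ?r t\<bar> \<le> 1 / real N" for t
  proof -
    have "\<bar>t - ?r t\<bar> = \<bar>real N * t - of_int \<lfloor>real N * t\<rfloor>\<bar> / real N"
      using assms(1) by (simp add: field_simps abs_mult)
    also have "\<dots> \<le> 1 / real N"
      by (intro divide_right_mono) linarith+
    finally show ?thesis .
  qed
  let ?w = "Complex (?r (Re z)) (?r (Im z))"
  have "?w \<in> coeff_grid N"
    using fl[of "Re z"] fl[of "Im z"] abs_Re_le_cmod[of z] abs_Im_le_cmod[of z] assms(2)
    unfolding coeff_grid_def by (intro image_eqI[of _ _ "(\<lfloor>real N * Re z\<rfloor>, \<lfloor>real N * Im z\<rfloor>)"]) auto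
  moreover have "cmod (z - ?w) \<le> 2 / real N"
    using cmod_le[of "z - ?w"] err[of "Re z"] err[of "Im z"] by simp
  ultimately show ?thesis by blast
qed

lemma freq_cube_eq: "freq_cube d n = PiE {1..d} (\<lambda>_. {1 - 2 ^ (n - 1)..2 ^ (n - 1) - 1})"
proof -
  have "{k::int. \<bar>k\<bar> \<le> 2 ^ (n - 1) - 1} = {1 - 2 ^ (n - 1)..2 ^ (n - 1) - 1}" by auto
  then show ?thesis by (simp only: freq_cube_def)
qed

lemma finite_freq_cube: "finite (freq_cube d n)"
  unfolding freq_cube_eq by (intro finite_PiE) auto

lemma card_freq_cube_le:
  assumes "1 \<le> n"
  shows "card (freq_cube d n) \<le> 2 ^ (n * d)"
proof -
  have "card (freq_cube d n) = nat (2 * 2 ^ (n - 1) - 1) ^ d"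
    by (simp add: freq_cube_eq card_PiE)
  also have "(2::int) * 2 ^ (n - 1) = 2 ^ n"
    using assms by (simp add: power_Suc[symmetric] del: power_Suc)
  also have "nat (2 ^ n - 1) ^ d \<le> (2 ^ n) ^ d"
    by (intro power_mono) (simp_all add: nat_le_iff)
  finally show ?thesis by (simp add: power_mult)
qed

text \<open>Choosing \<open>v\<close> frequencies independently, instead of a set of size
  \<open>v\<close>, overcounts but makes the parameter set a plain power. With mesh 1/(32v) each
  coefficient is off by at most 2/(32v), hence a sum of \<open>v\<close> terms by at most
  1/16.\<close>

definition sparse_net :: "nat \<Rightarrow> nat \<Rightarrow> nat \<Rightarrow> ((nat \<Rightarrow> real) \<Rightarrow> real) set" where
  "sparse_net d n v =
     (\<lambda>h x. cmod (char_sum d {..<v} (\<lambda>i. fst (h i)) (\<lambda>i. snd (h i)) x)) `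
       (PiE {..<v} (\<lambda>_. freq_cube d n \<times> coeff_grid (32 * v)))"

lemma finite_sparse_net: "finite (sparse_net d n v)"
  unfolding sparse_net_def
  by (intro finite_imageI finite_PiE) (auto simp: finite_freq_cube finite_coeff_grid)

text \<open>Each of the \<open>v\<close> positions has at most 2^(nd) frequencies and 2^(14 + 2nd)
  coefficients. The factor 2 on the left pays for the two tails in the sampling lemma.\<close>

lemma card_sparse_net_le:
  assumes "1 \<le> d" "1 \<le> n" "1 \<le> v" "v \<le> card (freq_cube d n)"
  shows "2 * real (card (sparse_net d n v)) \<le> exp (real (18 * n * d * v))"
proof -
  have v: "v \<le> 2 ^ (n * d)"
    using assms card_freq_cube_le[of n d] by linarith
  have "card (coeff_grid (32 * v)) \<le> (2 * (32 * v) + 1)\<^sup>2"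
    by (rule card_coeff_grid_le)
  \<comment> \<open>Here 64v + 1 is at most 128v, and \<open>v\<close> is at most the size of the
    frequency cube.\<close>
  also have "\<dots> \<le> (2 ^ 7 * 2 ^ (n * d))\<^sup>2"
    using v assms by (intro power_mono) auto
  also have "\<dots> = 2 ^ (14 + 2 * (n * d))"
    by (simp add: power_add power_mult_distrib power_mult[symmetric] mult.commute)
  finally have grid: "card (coeff_grid (32 * v)) \<le> 2 ^ (14 + 2 * (n * d))" .
  have "card (sparse_net d n v) \<le> card (PiE {..<v} (\<lambda>_. freq_cube d n \<times> coeff_grid (32 * v)))"
    unfolding sparse_net_def
    by (intro card_image_le finite_PiE) (auto simp: finite_freq_cube finite_coeff_grid)
  also have "\<dots> = (card (freq_cube d n) * card (coeff_grid (32 * v))) ^ v"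
    by (simp add: card_PiE card_cartesian_product)
  also have "\<dots> \<le> (2 ^ (n * d) * 2 ^ (14 + 2 * (n * d))) ^ v"
    using assms grid by (intro power_mono mult_mono card_freq_cube_le) auto
  also have "\<dots> = 2 ^ ((14 + 3 * (n * d)) * v)"
    by (simp add: power_add[symmetric] power_mult[symmetric] algebra_simps)
  finally have "2 * card (sparse_net d n v) \<le> 2 ^ (1 + (14 + 3 * (n * d)) * v)"
    by simp
  also have "\<dots> \<le> 2 ^ (18 * n * d * v)"
  proof -
    \<comment> \<open>The constant 14 is absorbed into 14nd, giving 17ndv, and the leading 1 into
      one more ndv.\<close>
    have nd: "1 \<le> n * d" using assms by simp
    then have "1 \<le> n * d * v" using assms by simp
    moreover have "(14 + 3 * (n * d)) * v \<le> (17 * (n * d)) * v"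
      using nd by (intro mult_right_mono) linarith+
    ultimately have "1 + (14 + 3 * (n * d)) * v \<le> 18 * n * d * v"
      by (simp only: mult.assoc)
    then show ?thesis by (intro power_increasing) auto
  qed
  finally have "2 * real (card (sparse_net d n v)) \<le> 2 ^ (18 * n * d * v)"
    by (metis of_nat_le_iff of_nat_mult of_nat_numeral of_nat_power)
  also have "\<dots> \<le> exp 1 ^ (18 * n * d * v)"
    using exp_ge_add_one_self[of "1::real"] by (intro power_mono) auto
  also have "\<dots> = exp (real (18 * n * d * v))"
    by (simp add: exp_of_nat_mult[symmetric])
  finally show ?thesis .
qed

lemma sparse_net_measurable:
  assumes "g \<in> sparse_net d n v"
  shows "g \<in> borel_measurable (torus_measure d)"
proof -
  obtain k c where "g = (\<lambda>x. cmod (char_sum d {..<v} k c x))"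
    using assms unfolding sparse_net_def by blast
  then show ?thesis by simp
qed

text \<open>There are \<open>v\<close> coefficients, each of modulus at most 2; this bound becomes
  \<open>B\<close> in the sampling lemma.\<close>

lemma sparse_net_bounds:
  assumes "g \<in> sparse_net d n v"
  shows "0 \<le> g x \<and> g x \<le> 2 * real v"
proof -
  obtain h where h: "h \<in> PiE {..<v} (\<lambda>_. freq_cube d n \<times> coeff_grid (32 * v))"
    and g: "g = (\<lambda>x. cmod (char_sum d {..<v} (\<lambda>i. fst (h i)) (\<lambda>i. snd (h i)) x))"
    using assms by (auto simp: sparse_net_def)
  have "g x \<le> (\<Sum>i<v. cmod (snd (h i)))"
    unfolding g by (rule norm_char_sum_le)
  also have "\<dots> \<le> real (card {..<v}) * 2"
    using h by (intro sum_bounded_above norm_coeff_grid_le[of _ "32 * v"]) (auto simp: PiE_iff mem_Times_iff)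
  finally show ?thesis by (simp add: g)
qed

lemma sparse_net_approx:
  assumes v: "1 \<le> v" and Q: "Q \<in> sparse_sets d v n" and c: "\<And>k. k \<in> Q \<Longrightarrow> cmod (c k) \<le> 1"
  shows "\<exists>g\<in>sparse_net d n v. \<forall>x. \<bar>cmod (char_sum d Q (\<lambda>k. k) c x) - g x\<bar> \<le> 1 / 16"
proof -
  \<comment> \<open>An infinite set has \<open>card\<close> 0, so \<open>1 \<le> v\<close> yields
    finiteness.\<close>
  have "Q \<subseteq> freq_cube d n" "card Q = v" "finite Q"
    using Q v by (auto simp: sparse_sets_def intro: card_ge_0_finite)
  then obtain k where k: "bij_betw k {..<v} Q"
    using ex_bij_betw_nat_finite[of Q] by (auto simp: atLeast0LessThan)
  have kQ: "k i \<in> Q" if "i < v" for i using k that by (auto simp: bij_betw_def)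
  have "\<exists>w\<in>coeff_grid (32 * v). cmod (c (k i) - w) \<le> 2 / real (32 * v)" if "i < v" for i
    using v c[OF kQ[OF that]] by (intro coeff_grid_approx) auto
  then obtain w where w: "\<And>i. i < v \<Longrightarrow> w i \<in> coeff_grid (32 * v)"
    "\<And>i. i < v \<Longrightarrow> cmod (c (k i) - w i) \<le> 2 / real (32 * v)"
    by metis
  define h where "h = restrict (\<lambda>i. (k i, w i)) {..<v}"
  let ?g = "\<lambda>x. cmod (char_sum d {..<v} (\<lambda>i. fst (h i)) (\<lambda>i. snd (h i)) x)"
  have "h \<in> PiE {..<v} (\<lambda>_. freq_cube d n \<times> coeff_grid (32 * v))"
    using kQ w(1) \<open>Q \<subseteq> freq_cube d n\<close> by (auto simp: h_def)
  then have "?g \<in> sparse_net d n v" by (auto simp: sparse_net_def)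
  moreover have "\<bar>cmod (char_sum d Q (\<lambda>k. k) c x) - ?g x\<bar> \<le> 1 / 16" for x
  proof -
    have "char_sum d Q (\<lambda>k. k) c x = char_sum d {..<v} k (\<lambda>i. c (k i)) x"
      unfolding char_sum_def using k by (rule sum.reindex_bij_betw[symmetric])
    moreover have "char_sum d {..<v} (\<lambda>i. fst (h i)) (\<lambda>i. snd (h i)) x = char_sum d {..<v} k w x"
      by (simp add: char_sum_def h_def)
    ultimately show ?thesis
      using norm_char_sum_diff_le[of "{..<v}" "\<lambda>i. c (k i)" w "2 / real (32 * v)" d k x] w(2) v
      by simp
  qed
  ultimately show ?thesis by (intro bexI[of _ ?g]) auto
qed

section \<open>From the net to all sparse polynomials\<close>

lemma char_sum_scale:
  "char_sum d I k (\<lambda>i. a * c i) x = a * char_sum d I k c x"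
  by (simp add: char_sum_def sum_distrib_left mult.assoc)

text \<open>Both inequalities are homogeneous, so \<open>f\<close> may be divided by its norm
  \<open>A\<close>. The result is uniformly within 1/16 of a net element, whose sample sums are
  controlled by \<open>net\<close>.\<close>

lemma discretization_of_net:
  fixes \<xi> :: "nat \<Rightarrow> nat \<Rightarrow> real" and c :: "(nat \<Rightarrow> int) \<Rightarrow> complex"
  assumes v: "1 \<le> v" and m: "1 \<le> m" and Q: "Q \<in> sparse_sets d v n"
    and net: "\<And>g. g \<in> sparse_net d n v \<Longrightarrow> 1/2 \<le> (LINT x|torus_measure d. g x) \<Longrightarrow>
      (LINT x|torus_measure d. g x) \<le> 2 \<Longrightarrow>
      real m / 8 \<le> (\<Sum>\<nu>=1..m. g (\<xi> \<nu>)) \<and> (\<Sum>\<nu>=1..m. g (\<xi> \<nu>)) \<le> 5 * real m"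
  defines "f \<equiv> char_sum d Q (\<lambda>k. k) c"
  shows "1 / 16 * L1_norm d f \<le> 1 / real m * (\<Sum>\<nu>=1..m. cmod (f (\<xi> \<nu>)))"
    and "1 / real m * (\<Sum>\<nu>=1..m. cmod (f (\<xi> \<nu>))) \<le> 6 * L1_norm d f"
proof -
  interpret prob_space "torus_measure d" by (rule prob_space_torus)
  have fin: "Q \<subseteq> freq_cube d n" "finite Q"
    using Q v by (auto simp: sparse_sets_def intro: card_ge_0_finite)
  note coeff = coeff_le_L1_norm[OF fin(2,1), of _ c, folded f_def]
  define A where "A = L1_norm d f"
  have "0 \<le> A" by (simp add: A_def L1_norm_def)
  have "1 / 16 * A \<le> 1 / real m * (\<Sum>\<nu>=1..m. cmod (f (\<xi> \<nu>))) \<and>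
        1 / real m * (\<Sum>\<nu>=1..m. cmod (f (\<xi> \<nu>))) \<le> 6 * A"
  proof (cases "A = 0")
    case True
    \<comment> \<open>A vanishing norm cannot be normalised, but it forces all coefficients, and
      hence \<open>f\<close>, to be 0.\<close>
    then have "c k = 0" if "k \<in> Q" for k using coeff[OF that] by (simp add: A_def)
    then have "f x = 0" for x by (simp add: f_def char_sum_def)
    then show ?thesis using True by simp
  next
    case False
    with \<open>0 \<le> A\<close> have A: "0 < A" by simp
    define c' where "c' k = complex_of_real (1 / A) * c k" for k
    define f' where "f' = char_sum d Q (\<lambda>k. k) c'"
    have f': "cmod (f' x) = cmod (f x) / A" for x
    proof -
      have "f' x = complex_of_real (1 / A) * f x"
        unfolding f'_def f_def c'_def by (rule char_sum_scale)
      then show ?thesis using A by (simp add: norm_mult norm_divide)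
    qed
    have "cmod (c' k) \<le> 1" if "k \<in> Q" for k
      using coeff[OF that] A by (simp add: c'_def norm_mult norm_divide A_def[symmetric])
    then obtain g where g: "g \<in> sparse_net d n v" and close: "\<And>x. \<bar>cmod (f' x) - g x\<bar> \<le> 1 / 16"
      using sparse_net_approx[OF v Q, of c'] unfolding f'_def by blast
    have I: "integrable (torus_measure d) (\<lambda>x. cmod (f' x))"
      unfolding f'_def by (rule integrable_norm_char_sum)
    have Ig: "integrable (torus_measure d) g"
      using sparse_net_bounds[OF g] sparse_net_measurable[OF g]
      by (intro integrable_const_bound[of _ "2 * real v"]) auto
    have E1: "expectation (\<lambda>x. cmod (f' x)) = 1"
      using A by (simp add: f' A_def L1_norm_def)
    have close': "g x \<le> cmod (f' x) + 1 / 16" "cmod (f' x) - 1 / 16 \<le> g x" for x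
      using close[of x] by linarith+
    \<comment> \<open>The mean of \<open>g\<close> is within 1/16 of 1, well inside [1/2, 2], so
      \<open>net\<close> applies to \<open>g\<close>.\<close>
    have "expectation g \<le> expectation (\<lambda>x. cmod (f' x) + 1 / 16)"
      using I Ig close' by (intro integral_mono) auto
    then have "expectation g \<le> 2" using I E1 by (simp add: prob_space)
    moreover have "expectation (\<lambda>x. cmod (f' x) - 1 / 16) \<le> expectation g"
      using I Ig close' by (intro integral_mono) auto
    then have "1/2 \<le> expectation g" using I E1 by (simp add: prob_space)
    ultimately have S: "real m / 8 \<le> (\<Sum>\<nu>=1..m. g (\<xi> \<nu>))" "(\<Sum>\<nu>=1..m. g (\<xi> \<nu>)) \<le> 5 * real m"
      using net[OF g] by auto
    let ?S = "\<Sum>\<nu>=1..m. cmod (f' (\<xi> \<nu>))"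
    have "\<bar>?S - (\<Sum>\<nu>=1..m. g (\<xi> \<nu>))\<bar> \<le> (\<Sum>\<nu>=1..m. \<bar>cmod (f' (\<xi> \<nu>)) - g (\<xi> \<nu>)\<bar>)"
      unfolding sum_subtractf[symmetric] by (rule sum_abs)
    also have "\<dots> \<le> real (card {1..m}) * (1 / 16)"
      using close by (intro sum_bounded_above) auto
    finally have "\<bar>?S - (\<Sum>\<nu>=1..m. g (\<xi> \<nu>))\<bar> \<le> real m / 16"
      by simp
    \<comment> \<open>The final constants arise here: 1/8 - 1/16 = 1/16, and 5 + 1/16 is below
      6.\<close>
    then have "real m / 16 \<le> ?S" "?S \<le> 6 * real m"
      using S by linarith+
    then have "real m / 16 * A \<le> ?S * A" "?S * A \<le> 6 * real m * A"
      using A by (auto intro: mult_right_mono)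
    moreover have "?S * A = (\<Sum>\<nu>=1..m. cmod (f (\<xi> \<nu>)))"
      using A by (simp add: f' sum_divide_distrib[symmetric])
    ultimately show ?thesis
      using m by (simp add: field_simps)
  qed
  then show "1 / 16 * L1_norm d f \<le> 1 / real m * (\<Sum>\<nu>=1..m. cmod (f (\<xi> \<nu>)))"
    and "1 / real m * (\<Sum>\<nu>=1..m. cmod (f (\<xi> \<nu>))) \<le> 6 * L1_norm d f"
    by (simp_all add: A_def)
qed

text \<open>The sampling lemma needs 8BL points; with B = 2v and L = 18ndv this is exactly 288 d n
  v^2.\<close>

lemma exists_universal_L1_discretization:
  assumes "1 \<le> d" "1 \<le> n" "1 \<le> v" "v \<le> card (freq_cube d n)"
  defines "m \<equiv> 288 * d * n * v\<^sup>2"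
  shows "\<exists>\<xi>. \<xi> ` {1..m} \<subseteq> torus d \<and> inj_on \<xi> {1..m} \<and>
           universal_L1_discretization d (sparse_sets d v n) (1 / 16) 6 m \<xi>"
proof -
  interpret prob_space "torus_measure d" by (rule prob_space_torus)
  \<comment> \<open>Net elements with a mean outside this range approximate no normalised polynomial
    and are not sampled.\<close>
  define G where "G = {g \<in> sparse_net d n v. 1/2 \<le> expectation g \<and> expectation g \<le> 2}"
  have "finite G" by (simp add: G_def finite_sparse_net)
  have "card G \<le> card (sparse_net d n v)"
    unfolding G_def by (intro card_mono finite_sparse_net) auto
  then have card: "2 * real (card G) \<le> exp (real (18 * n * d * v))"
    using card_sparse_net_le[OF assms(1-4)] by linarith
  have m: "8 * (2 * real v) * real (18 * n * d * v) \<le> real m"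
    by (simp add: m_def power2_eq_square)
  have "\<exists>\<xi> :: nat \<Rightarrow> nat \<Rightarrow> real. inj_on \<xi> {1..m} \<and> (\<forall>\<nu>\<in>{1..m}. \<xi> \<nu> \<in> torus d) \<and>
      (\<forall>g\<in>G. real m / 8 \<le> (\<Sum>\<nu>=1..m. g (\<xi> \<nu>)) \<and> (\<Sum>\<nu>=1..m. g (\<xi> \<nu>)) \<le> 5 * real m)"
  proof (rule exists_points_sampling[OF \<open>finite G\<close> _ _ _ _ AE_torus AE_torus_neq[OF assms(1)] m card])
    show "0 < 2 * real v" using assms(3) by simp
    show "g \<in> borel_measurable (torus_measure d)" if "g \<in> G" for g
      using that sparse_net_measurable[of g d n v] by (simp add: G_def)
    show "0 \<le> g x \<and> g x \<le> 2 * real v" if "g \<in> G" for g x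
      using that sparse_net_bounds[of g d n v] by (simp add: G_def)
    show "1/2 \<le> expectation g \<and> expectation g \<le> 2" if "g \<in> G" for g
      using that by (simp add: G_def)
  qed
  then obtain \<xi> :: "nat \<Rightarrow> nat \<Rightarrow> real" where \<xi>: "inj_on \<xi> {1..m}" "\<forall>\<nu>\<in>{1..m}. \<xi> \<nu> \<in> torus d"
    "\<forall>g\<in>G. real m / 8 \<le> (\<Sum>\<nu>=1..m. g (\<xi> \<nu>)) \<and> (\<Sum>\<nu>=1..m. g (\<xi> \<nu>)) \<le> 5 * real m"
    by blast
  have m1: "1 \<le> m" using assms(1-3) by (simp add: m_def)
  have "universal_L1_discretization d (sparse_sets d v n) (1 / 16) 6 m \<xi>"
    unfolding universal_L1_discretization_def
  proof (rule ballI)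
    fix f assume "f \<in> (\<Union>Q\<in>sparse_sets d v n. trig_polys d Q)"
    then obtain Q c where Q: "Q \<in> sparse_sets d v n" and f: "f = char_sum d Q (\<lambda>k. k) c"
      by (auto simp: trig_polys_def char_sum_def[abs_def] character_def)
    show "1 / 16 * L1_norm d f \<le> 1 / real m * (\<Sum>\<nu>=1..m. cmod (f (\<xi> \<nu>))) \<and>
        1 / real m * (\<Sum>\<nu>=1..m. cmod (f (\<xi> \<nu>))) \<le> 6 * L1_norm d f"
      using discretization_of_net[OF assms(3) m1 Q, of \<xi> c] \<xi>(3) unfolding f by (auto simp: G_def)
  qed
  then show ?thesis using \<xi> by blast
qed

theorem theorem7p6:
  "\<exists>(C1 :: nat \<Rightarrow> real) (C2 :: real) (C3 :: real).
     (\<forall>d\<ge>1. C1 d > 0) \<and> C2 > 0 \<and> C3 > 0 \<and>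
     (\<forall>d\<ge>1. \<forall>n\<ge>1. \<forall>v\<ge>1. v \<le> card (freq_cube d n) \<longrightarrow>
        (\<exists>(m :: nat) (\<xi> :: nat \<Rightarrow> nat \<Rightarrow> real).
           m \<ge> 1 \<and>
           real m \<le> C1 d * (real v)\<^sup>2 * real n powr (9 / 2) \<and>
           \<xi> ` {1..m} \<subseteq> torus d \<and> inj_on \<xi> {1..m} \<and>
           universal_L1_discretization d (sparse_sets d v n) C2 C3 m \<xi>))"
proof (rule exI[of _ "\<lambda>d. 288 * real d"], rule exI[of _ "1 / 16"], rule exI[of _ 6],
    intro conjI allI impI)
  fix d n v :: nat
  assume *: "1 \<le> d" "1 \<le> n" "1 \<le> v" "v \<le> card (freq_cube d n)"
  let ?m = "288 * d * n * v\<^sup>2"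
  \<comment> \<open>The point count is linear in \<open>n\<close>, which for n at least 1 is within
    the allowed power; its factor \<open>288 * d\<close> goes into \<open>C1\<close>, while 1/16 and
    6 are free of \<open>d\<close>.\<close>
  have "real n \<le> real n powr (9 / 2)"
    using powr_mono[of 1 "9 / 2" "real n"] *(2) by simp
  then have "real ?m \<le> 288 * real d * (real v)\<^sup>2 * real n powr (9 / 2)"
    using mult_left_mono[of "real n" "real n powr (9 / 2)" "288 * real d * (real v)\<^sup>2"]
    by (simp add: mult_ac)
  moreover have "1 \<le> ?m" using * by simp
  ultimately show "\<exists>m \<xi>. 1 \<le> m \<and> real m \<le> 288 * real d * (real v)\<^sup>2 * real n powr (9 / 2) \<and>
      \<xi> ` {1..m} \<subseteq> torus d \<and> inj_on \<xi> {1..m} \<and>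
      universal_L1_discretization d (sparse_sets d v n) (1 / 16) 6 m \<xi>"
    using exists_universal_L1_discretization[OF *] by blast
qed auto

end
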